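(* Let $n\in\mathbb{N}$ and let $X_1,\dots,X_n$ be random variables. Let $a_1,\dots,a_n,b,c_1,\dots,c_n$ be $2n+1$ real constants such that $a_1,\dots,a_n\le 0$, $b>0$, $a_i\le X_i\le a_i+b$ almost surely for all $i\in[n]$, and \[ \mathbb{E}\Big[\prod_{i\in S}X_i\Big]\le \prod_{i\in S}c_i \quad\text{for all } S\subseteq[n]. \] Set $X:=\sum_{i=1}^n X_i$, $a:=\frac1n\sum_{i=1}^n a_i$ and $c:=\frac1n\sum_{i=1}^n c_i$. Then for every $t\in[0,b+a-c]$, \[ \mathbb{P}\big(X\ge (c+t)n\big)\le e^{-D\left(\frac{c-a+t}{b}\,\middle\|\,\frac{c-a}{b}\right)n}. \]
   Context: $[n]:=\{1,\dots,n\}$. For $p,q\in[0,1]$, $D(p\,\|\,q):=p\ln(p/q)+(1-p)\ln((1-p)/(1-q))$ is the binary relative entropy, with the conventions $0\ln 0=0$ and $\ln(x/0)=\infty$ for all $x\in(0,1]$. The empty product equals $1$. *)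

theory Defs
  imports "HOL-Probability.Probability"
begin

(* ln (x / y) for x, y in [0,1], with ln (x / 0) = \<infinity>.  The values at x = 0 (the library's
   ln 0 = 0 for y > 0, and \<infinity> for y = 0) are irrelevant: below they are always multiplied
   by 0, and 0 * \<infinity> = 0 in ereal, which is the convention 0 ln 0 = 0. *)
definition ln_quot :: "real \<Rightarrow> real \<Rightarrow> ereal" where
  "ln_quot x y = (if y = 0 then \<infinity> else ereal (ln (x / y)))"

definition bin_rel_entropy :: "real \<Rightarrow> real \<Rightarrow> ereal" where
  "bin_rel_entropy p q = ereal p * ln_quot p q + ereal (1 - p) * ln_quot (1 - p) (1 - q)"

definition ereal_exp :: "ereal \<Rightarrow> ereal" where
  "ereal_exp x = (case x of ereal r \<Rightarrow> ereal (exp r) | PInfty \<Rightarrow> \<infinity> | MInfty \<Rightarrow> 0)"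

lemma ereal_exp_simps [simp]:
  "ereal_exp (ereal r) = ereal (exp r)"
  "ereal_exp \<infinity> = \<infinity>"
  "ereal_exp (- \<infinity>) = 0"
  by (simp_all add: ereal_exp_def)

lemma bin_rel_entropy_finite:
  assumes "0 < q" "q < 1"
  shows "bin_rel_entropy p q = ereal (p * ln (p / q) + (1 - p) * ln ((1 - p) / (1 - q)))"
  using assms by (simp add: bin_rel_entropy_def ln_quot_def)

lemma bin_rel_entropy_endpoints:
  shows "bin_rel_entropy 0 0 = 0"
    and "bin_rel_entropy 1 1 = 0"
    and "0 < p \<Longrightarrow> p \<le> 1 \<Longrightarrow> bin_rel_entropy p 0 = \<infinity>"
    and "0 \<le> p \<Longrightarrow> p < 1 \<Longrightarrow> bin_rel_entropy p 1 = \<infinity>"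
  by (simp_all add: bin_rel_entropy_def ln_quot_def)

end

theory Submission
  imports Defs "HOL-Real_Asymp.Real_Asymp"
begin

text \<open>
  Bound the exponential \<open>exp (\<lambda> x)\<close> on \<open>[a i, a i + b]\<close> by its chord
  \<open>exp (\<lambda> a i) (1 - s a i + s x)\<close> with \<open>s = (exp (\<lambda> b) - 1) / b\<close>. Because \<open>a i \<le> 0\<close>, both coefficients
  of the chord are nonnegative, so expanding the product of the chords over subsets of the index set
  lets the hypothesis on mixed moments replace each \<open>X i\<close> by \<open>c i\<close>. The AM-GM inequality, Markov's
  inequality and optimisation over \<open>\<lambda>\<close> then give the relative entropy.
\<close>

text \<open>Raising \<open>arith_geom_mean\<close> to the power \<open>card S\<close> removes the
  root. In the Chernoff bound this replaces the individual \<open>c i - a i\<close> by their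
  average.\<close>

lemma prod_le_mean_power:
  fixes x :: "'a \<Rightarrow> real"
  assumes "finite S" "S \<noteq> {}" "\<And>i. i \<in> S \<Longrightarrow> x i \<ge> 0"
  shows "(\<Prod>i\<in>S. x i) \<le> ((\<Sum>i\<in>S. x i) / card S) ^ card S"
proof -
  have pos: "card S > 0" and nonneg: "(\<Prod>i\<in>S. x i) \<ge> 0"
    using assms by (auto intro: prod_nonneg simp: card_gt_0_iff)
  have "(\<Prod>i\<in>S. x i) = ((\<Prod>i\<in>S. x i) powr (1 / card S)) ^ card S"
    using pos nonneg by (cases "(\<Prod>i\<in>S. x i) = 0") (auto simp: powr_realpow' powr_powr powr_power)
  also have "\<dots> \<le> (\<Sum>i\<in>S. x i / card S) ^ card S"
    using arith_geom_mean[OF assms] by (intro power_mono) auto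
  finally show ?thesis
    by (simp add: sum_divide_distrib)
qed

text \<open>Convexity of \<open>exp\<close> between the endpoints of the interval. With
  \<open>exp (l * a)\<close> factored out, the slope \<open>(exp (l * b) - 1) / b\<close> does not
  depend on \<open>a\<close>, so a single \<open>s\<close> serves all variables.\<close>

lemma exp_le_chord:
  fixes l a b x :: real
  assumes "b > 0" "a \<le> x" "x \<le> a + b"
  shows "exp (l * x) \<le> exp (l * a) * (1 - (exp (l * b) - 1) / b * a + (exp (l * b) - 1) / b * x)"
proof -
  define y where "y = (x - a) / b"
  have y: "0 \<le> y" "y \<le> 1" "x = a + y * b"
    using assms by (auto simp: y_def field_simps)
  have "exp ((1 - y) *\<^sub>R (l * a) + y *\<^sub>R (l * (a + b))) \<le> (1 - y) * exp (l * a) + y * exp (l * (a + b))"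
    using y by (intro convex_onD[OF exp_convex]) auto
  also have "(1 - y) *\<^sub>R (l * a) + y *\<^sub>R (l * (a + b)) = l * x"
    by (simp add: y(3) algebra_simps)
  also have "(1 - y) * exp (l * a) + y * exp (l * (a + b))
      = exp (l * a) * (1 + (exp (l * b) - 1) * y)"
    by (simp add: algebra_simps exp_add)
  also have "\<dots> = exp (l * a) * (1 - (exp (l * b) - 1) / b * a + (exp (l * b) - 1) / b * x)"
    using assms(1) by (simp add: y_def field_simps)
  finally show ?thesis .
qed

text \<open>Almost sure bounds on the factors multiply to one on the product. This integrability
  allows the subset expansion to be integrated term by term.\<close>

lemma (in finite_measure) integrable_prod_AE_bounded:
  fixes X :: "'i \<Rightarrow> 'a \<Rightarrow> real"
  assumes "finite S" "\<And>i. i \<in> S \<Longrightarrow> X i \<in> borel_measurable M"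
    and "\<And>i. i \<in> S \<Longrightarrow> AE \<omega> in M. \<bar>X i \<omega>\<bar> \<le> B i"
  shows "integrable M (\<lambda>\<omega>. \<Prod>i\<in>S. X i \<omega>)"
proof (rule integrable_const_bound[where B = "\<Prod>i\<in>S. B i"])
  have "AE \<omega> in M. \<forall>i\<in>S. \<bar>X i \<omega>\<bar> \<le> B i"
    using assms by (intro AE_finite_allI) auto
  then show "AE \<omega> in M. norm (\<Prod>i\<in>S. X i \<omega>) \<le> (\<Prod>i\<in>S. B i)"
    by eventually_elim (auto simp: abs_prod intro!: prod_mono)
qed (use assms in measurable)

text \<open>The coefficients \<open>s ^ card S * (\<Prod>i\<in>I - S. k i)\<close> of the expansion
  are nonnegative, so the upper bounds on the mixed moments can be summed without reversing any
  inequality.\<close>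

lemma integral_prod_affine_le:
  fixes X :: "'i \<Rightarrow> 'a \<Rightarrow> real"
  assumes "finite I"
    and "\<And>S. S \<subseteq> I \<Longrightarrow> integrable M (\<lambda>\<omega>. \<Prod>i\<in>S. X i \<omega>)"
    and "\<And>S. S \<subseteq> I \<Longrightarrow> (\<integral>\<omega>. (\<Prod>i\<in>S. X i \<omega>) \<partial>M) \<le> (\<Prod>i\<in>S. c i)"
    and "s \<ge> 0" "\<And>i. i \<in> I \<Longrightarrow> k i \<ge> 0"
  shows "integrable M (\<lambda>\<omega>. \<Prod>i\<in>I. k i + s * X i \<omega>)"
    and "(\<integral>\<omega>. (\<Prod>i\<in>I. k i + s * X i \<omega>) \<partial>M) \<le> (\<Prod>i\<in>I. k i + s * c i)"
proof -
  \<comment> \<open>Stated for arbitrary \<open>z\<close>: it expands the product in the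
    \<open>X i \<omega>\<close> and, at \<open>z = c\<close>, collapses the bounding sum
    again.\<close>
  have expand: "(\<Prod>i\<in>I. k i + s * z i)
      = (\<Sum>S\<in>Pow I. (s ^ card S * (\<Prod>i\<in>I - S. k i)) * (\<Prod>i\<in>S. z i))" for z :: "'i \<Rightarrow> real"
    by (subst add.commute, subst prod_add[OF assms(1)]) (simp add: prod.distrib mult_ac)
  show "integrable M (\<lambda>\<omega>. \<Prod>i\<in>I. k i + s * X i \<omega>)"
    unfolding expand using assms(2) by (intro Bochner_Integration.integrable_sum) auto
  have "(\<integral>\<omega>. (\<Prod>i\<in>I. k i + s * X i \<omega>) \<partial>M)
      = (\<Sum>S\<in>Pow I. (s ^ card S * (\<Prod>i\<in>I - S. k i)) * (\<integral>\<omega>. (\<Prod>i\<in>S. X i \<omega>) \<partial>M))"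
    unfolding expand using assms(2) by (subst Bochner_Integration.integral_sum) auto
  also have "\<dots> \<le> (\<Prod>i\<in>I. k i + s * c i)"
    unfolding expand using assms
    by (intro sum_mono mult_left_mono mult_nonneg_nonneg prod_nonneg) auto
  finally show "(\<integral>\<omega>. (\<Prod>i\<in>I. k i + s * X i \<omega>) \<partial>M) \<le> (\<Prod>i\<in>I. k i + s * c i)" .
qed

text \<open>The tail bound before optimising over \<open>l\<close>. With \<open>u = l * b\<close>
  and \<open>q\<close> the average of the \<open>(c i - a i) / b\<close>, the base of the power is
  \<open>1 - q + q * exp u\<close>, for \<open>q \<le> 1\<close> the moment generating function of a
  Bernoulli variable of mean \<open>q\<close>.\<close>

lemma (in prob_space) Chernoff_bound_submultiplicative_moments:
  fixes X :: "'i \<Rightarrow> 'a \<Rightarrow> real" and a c :: "'i \<Rightarrow> real" and b l r :: real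
  assumes "finite I" "I \<noteq> {}"
    and "\<And>i. i \<in> I \<Longrightarrow> X i \<in> borel_measurable M"
    and "\<And>i. i \<in> I \<Longrightarrow> a i \<le> 0" "b > 0"
    and "\<And>i. i \<in> I \<Longrightarrow> AE \<omega> in M. a i \<le> X i \<omega> \<and> X i \<omega> \<le> a i + b"
    and moments: "\<And>S. S \<subseteq> I \<Longrightarrow> (\<integral>\<omega>. (\<Prod>i\<in>S. X i \<omega>) \<partial>M) \<le> (\<Prod>i\<in>S. c i)"
    and "l \<ge> 0"
  shows "measure M {\<omega> \<in> space M. (\<Sum>i\<in>I. X i \<omega>) \<ge> r}
    \<le> exp (l * ((\<Sum>i\<in>I. a i) - r))
        * (1 + (exp (l * b) - 1) / b * (((\<Sum>i\<in>I. c i) - (\<Sum>i\<in>I. a i)) / card I)) ^ card I"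
    and "\<And>i. i \<in> I \<Longrightarrow> a i \<le> c i"
proof -
  define s where "s = (exp (l * b) - 1) / b"
  have s: "s \<ge> 0"
    using \<open>b > 0\<close> \<open>l \<ge> 0\<close> by (simp add: s_def)
  have "AE \<omega> in M. \<bar>X i \<omega>\<bar> \<le> \<bar>a i\<bar> + b" if "i \<in> I" for i
    using assms(6)[OF that] by eventually_elim auto
  then have int: "integrable M (\<lambda>\<omega>. \<Prod>i\<in>S. X i \<omega>)" if "S \<subseteq> I" for S
    using that assms(1,3) finite_subset
    by (intro integrable_prod_AE_bounded[where B = "\<lambda>i. \<bar>a i\<bar> + b"]) auto
  \<comment> \<open>The moment hypothesis at \<open>S = {i}\<close> bounds the mean of
    \<open>X i\<close>, which is at least \<open>a i\<close>. This makes the factors in the AM-GM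
    step nonnegative.\<close>
  show ac: "a i \<le> c i" if "i \<in> I" for i
  proof -
    have "a i = (\<integral>\<omega>. a i \<partial>M)"
      by (simp add: prob_space)
    also have "\<dots> \<le> (\<integral>\<omega>. X i \<omega> \<partial>M)"
      using int[of "{i}"] assms(6)[OF that] that by (intro integral_mono_AE) auto
    also have "\<dots> \<le> c i"
      using moments[of "{i}"] that by simp
    finally show ?thesis .
  qed
  \<comment> \<open>Here \<open>a i \<le> 0\<close> enters: it makes the constant term of the chord
    nonnegative.\<close>
  have k: "1 - s * a i \<ge> 0" if "i \<in> I" for i
    using s assms(4)[OF that] mult_nonneg_nonpos[of s "a i"] by linarith
  note affine = integral_prod_affine_le[OF \<open>finite I\<close> int moments s k]
  \<comment> \<open>The product of the chords: an almost sure majorant giving both integrability of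
    the exponential and the bound on its mean.\<close>
  define f where "f \<omega> = exp (l * (\<Sum>i\<in>I. a i)) * (\<Prod>i\<in>I. 1 - s * a i + s * X i \<omega>)" for \<omega>
  have AE_all: "AE \<omega> in M. \<forall>i\<in>I. a i \<le> X i \<omega> \<and> X i \<omega> \<le> a i + b"
    using assms(1,6) by (intro AE_finite_allI) auto
  have f_int: "integrable M f"
    unfolding f_def using affine(1) by auto
  have exp_le: "AE \<omega> in M. exp (l * (\<Sum>i\<in>I. X i \<omega>)) \<le> f \<omega>"
    using AE_all
  proof eventually_elim
    case (elim \<omega>)
    have "exp (l * (\<Sum>i\<in>I. X i \<omega>)) = (\<Prod>i\<in>I. exp (l * X i \<omega>))"
      using \<open>finite I\<close> by (simp add: sum_distrib_left exp_sum)
    also have "\<dots> \<le> (\<Prod>i\<in>I. exp (l * a i) * (1 - s * a i + s * X i \<omega>))"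
      unfolding s_def using elim \<open>b > 0\<close> by (intro prod_mono conjI exp_le_chord) auto
    also have "\<dots> = f \<omega>"
      using \<open>finite I\<close> by (simp add: f_def prod.distrib sum_distrib_left exp_sum)
    finally show ?case .
  qed
  have exp_int: "integrable M (\<lambda>\<omega>. exp (l * (\<Sum>i\<in>I. X i \<omega>)))"
    using assms(3) exp_le by (intro Bochner_Integration.integrable_bound[OF f_int]) auto
  have "(\<integral>\<omega>. exp (l * (\<Sum>i\<in>I. X i \<omega>)) \<partial>M) \<le> (\<integral>\<omega>. f \<omega> \<partial>M)"
    using exp_int f_int exp_le by (rule integral_mono_AE)
  also have "\<dots> \<le> exp (l * (\<Sum>i\<in>I. a i)) * (\<Prod>i\<in>I. 1 - s * a i + s * c i)"
    unfolding f_def using affine(2) by simp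
  also have "(\<Prod>i\<in>I. 1 - s * a i + s * c i)
      \<le> ((\<Sum>i\<in>I. 1 - s * a i + s * c i) / card I) ^ card I"
  proof (intro prod_le_mean_power assms(1,2))
    show "1 - s * a i + s * c i \<ge> 0" if "i \<in> I" for i
      using mult_left_mono[OF ac[OF that] s] by linarith
  qed
  also have "(\<Sum>i\<in>I. 1 - s * a i + s * c i) / card I
      = 1 + s * (((\<Sum>i\<in>I. c i) - (\<Sum>i\<in>I. a i)) / card I)"
    using assms(1,2)
    by (simp add: sum.distrib sum_subtractf field_simps flip: sum_distrib_left)
  finally have mgf: "(\<integral>\<omega>. exp (l * (\<Sum>i\<in>I. X i \<omega>)) \<partial>M) \<le> exp (l * (\<Sum>i\<in>I. a i))
      * (1 + s * (((\<Sum>i\<in>I. c i) - (\<Sum>i\<in>I. a i)) / card I)) ^ card I"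
    by simp
  \<comment> \<open>Only an inclusion of events: at \<open>l = 0\<close> the event on the right is
    the whole space.\<close>
  have "measure M {\<omega> \<in> space M. (\<Sum>i\<in>I. X i \<omega>) \<ge> r}
      \<le> measure M {\<omega> \<in> space M. exp (l * (\<Sum>i\<in>I. X i \<omega>)) \<ge> exp (l * r)}"
    using assms(3) \<open>l \<ge> 0\<close> by (intro finite_measure_mono) (auto intro: mult_left_mono)
  also have "\<dots> \<le> (\<integral>\<omega>. exp (l * (\<Sum>i\<in>I. X i \<omega>)) \<partial>M) / exp (l * r)"
    using exp_int by (intro integral_Markov_inequality_measure[where A = "{}"]) auto
  also have "\<dots> \<le> exp (l * (\<Sum>i\<in>I. a i))
      * (1 + s * (((\<Sum>i\<in>I. c i) - (\<Sum>i\<in>I. a i)) / card I)) ^ card I / exp (l * r)"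
    using mgf by (intro divide_right_mono) auto
  also have "\<dots> = exp (l * ((\<Sum>i\<in>I. a i) - r))
      * (1 + s * (((\<Sum>i\<in>I. c i) - (\<Sum>i\<in>I. a i)) / card I)) ^ card I"
    by (simp add: right_diff_distrib exp_diff)
  finally show "measure M {\<omega> \<in> space M. (\<Sum>i\<in>I. X i \<omega>) \<ge> r}
    \<le> exp (l * ((\<Sum>i\<in>I. a i) - r))
        * (1 + (exp (l * b) - 1) / b * (((\<Sum>i\<in>I. c i) - (\<Sum>i\<in>I. a i)) / card I)) ^ card I"
    by (simp only: s_def)
qed

text \<open>
  In the interior the optimal \<open>u\<close> is \<open>ln (p (1 - q) / (q (1 - p)))\<close>; for \<open>q = 0 < p\<close> and for \<open>q < p = 1\<close>
  the infimum is only approached in the limit \<open>u \<rightarrow> \<infinity>\<close>.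
\<close>

lemma le_exp_bin_rel_entropy:
  fixes p q y :: real and n :: nat
  assumes "0 \<le> q" "q \<le> p" "p \<le> 1" "n \<ge> 1"
    and bound: "\<And>u. u \<ge> 0 \<Longrightarrow> y \<le> (exp (- u * p) * (1 - q + q * exp u)) ^ n"
  shows "ereal y \<le> ereal_exp (- (bin_rel_entropy p q * ereal (real n)))"
proof -
  have y_le_1: "y \<le> 1"
    using bound[of 0] by simp
  \<comment> \<open>The bound for all \<open>u \<ge> 0\<close> survives the limit; this serves the
    two cases whose infimum is not attained.\<close>
  have limit: "y \<le> L ^ n"
    if "((\<lambda>u. exp (- u * p) * (1 - q + q * exp u)) \<longlongrightarrow> L) at_top" for L
  proof (rule tendsto_lowerbound[OF tendsto_power[OF that]])
    show "\<forall>\<^sub>F u in at_top. y \<le> (exp (- u * p) * (1 - q + q * exp u)) ^ n"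
      using eventually_ge_at_top[of 0] by eventually_elim (rule bound)
  qed simp
  \<comment> \<open>\<open>q = 1\<close> forces \<open>p = 1\<close>. There, as for
    \<open>p = q = 0\<close>, the entropy is \<open>0\<close> and the bound at \<open>u = 0\<close>
    suffices.\<close>
  consider "q = 0" "p = 0" | "q = 0" "p > 0" | "q = 1" | "0 < q" "q < 1" "p = 1"
    | "0 < q" "q < 1" "p < 1"
    using assms by linarith
  then show ?thesis
  proof cases
    case 1
    then show ?thesis
      using y_le_1 by (simp add: bin_rel_entropy_endpoints zero_ereal_def)
  next
    case 2
    \<comment> \<open>For \<open>q = 0\<close> the second factor is \<open>1\<close>. The limit
      gives \<open>y \<le> 0 ^ n = 0\<close>, as \<open>n \<ge> 1\<close>, which matches the
      infinite entropy.\<close>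
    have "((\<lambda>u. exp (- u * p)) \<longlongrightarrow> 0) at_top"
      using \<open>p > 0\<close> by real_asymp
    then have "y \<le> 0"
      using limit[of 0] 2 \<open>n \<ge> 1\<close> by (simp add: power_0_left)
    then show ?thesis
      using 2 assms by (simp add: bin_rel_entropy_endpoints)
  next
    case 3
    then show ?thesis
      using y_le_1 assms by (simp add: bin_rel_entropy_endpoints zero_ereal_def)
  next
    case 4
    \<comment> \<open>The limit \<open>q\<close> is the right one because the entropy at
      \<open>p = 1\<close> is \<open>- ln q\<close>.\<close>
    have "((\<lambda>u. exp (- u * 1) * (1 - q + q * exp u)) \<longlongrightarrow> q) at_top"
      using 4 by real_asymp
    then have "y \<le> q ^ n"
      using limit 4 by simp
    also have "q ^ n = exp (ln q * n)"
      using 4 by (simp add: exp_of_nat2_mult)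
    finally show ?thesis
      using 4 by (simp add: bin_rel_entropy_finite ln_div)
  next
    case 5
    define u where "u = ln (p * (1 - q) / (q * (1 - p)))"
    have p: "p > 0"
      using 5 assms by simp
    \<comment> \<open>\<open>q \<le> p\<close> compares the odds of \<open>p\<close> and
      \<open>q\<close>, so the minimiser lies in the range \<open>u \<ge> 0\<close> where
      \<open>bound\<close> is available.\<close>
    have "p * (1 - q) / (q * (1 - p)) \<ge> 1"
      using 5 assms by (simp add: field_simps)
    then have "u \<ge> 0"
      by (simp add: u_def)
    have "exp u = p * (1 - q) / (q * (1 - p))"
      using 5 p by (simp add: u_def)
    then have "1 - q + q * exp u = (1 - q) / (1 - p)"
      using 5 by (simp add: field_simps)
    also have "\<dots> = exp (ln (1 - q) - ln (1 - p))"
      using 5 by (simp add: exp_diff)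
    finally have "exp (- u * p) * (1 - q + q * exp u) = exp (- u * p + (ln (1 - q) - ln (1 - p)))"
      by (simp only: exp_add)
    moreover have "u = ln p + ln (1 - q) - (ln q + ln (1 - p))"
      using 5 p by (simp add: u_def ln_div ln_mult)
    moreover have "- (ln p + ln (1 - q) - (ln q + ln (1 - p))) * p + (ln (1 - q) - ln (1 - p))
        = - (p * ln (p / q) + (1 - p) * ln ((1 - p) / (1 - q)))"
      using 5 p by (simp add: ln_div algebra_simps)
    ultimately have "y \<le> exp (- (p * ln (p / q) + (1 - p) * ln ((1 - p) / (1 - q)))) ^ n"
      using bound[OF \<open>u \<ge> 0\<close>] by simp
    also have "\<dots> = exp (- ((p * ln (p / q) + (1 - p) * ln ((1 - p) / (1 - q))) * n))"
      by (simp only: exp_of_nat2_mult[symmetric] mult_minus_left)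
    finally show ?thesis
      using 5 by (simp only: bin_rel_entropy_finite times_ereal.simps uminus_ereal.simps
          ereal_exp_simps ereal_less_eq)
  qed
qed

theorem theorem1:
  fixes M :: "'w measure"
    and n :: nat
    and X :: "nat \<Rightarrow> 'w \<Rightarrow> real"
    and a c :: "nat \<Rightarrow> real"
    and b abar cbar t :: real
  assumes "prob_space M"
    and "n \<ge> 1"
    and "\<And>i. i \<in> {1..n} \<Longrightarrow> X i \<in> borel_measurable M"
    and "\<And>i. i \<in> {1..n} \<Longrightarrow> a i \<le> 0"
    and "b > 0"
    and "\<And>i. i \<in> {1..n} \<Longrightarrow> AE \<omega> in M. a i \<le> X i \<omega> \<and> X i \<omega> \<le> a i + b"
    and "\<And>S. S \<subseteq> {1..n} \<Longrightarrow> (\<integral>\<omega>. (\<Prod>i\<in>S. X i \<omega>) \<partial>M) \<le> (\<Prod>i\<in>S. c i)"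
    and "abar = (\<Sum>i=1..n. a i) / real n"
    and "cbar = (\<Sum>i=1..n. c i) / real n"
    and "t \<in> {0..b + abar - cbar}"
  shows "ereal (measure M {\<omega> \<in> space M. (\<Sum>i=1..n. X i \<omega>) \<ge> (cbar + t) * real n})
    \<le> ereal_exp (- (bin_rel_entropy ((cbar - abar + t) / b) ((cbar - abar) / b) * ereal (real n)))"
proof -
  interpret prob_space M by fact
  \<comment> \<open>The map \<open>x \<mapsto> (x - abar) / b\<close> takes
    \<open>[abar, abar + b]\<close>, the range of the average of the \<open>X i\<close>, to
    \<open>[0, 1]\<close>; it sends \<open>cbar\<close> to \<open>q\<close> and the threshold
    \<open>cbar + t\<close> to \<open>p\<close>.\<close>
  define p q where "p = (cbar - abar + t) / b" and "q = (cbar - abar) / b"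
  have sums: "(\<Sum>i=1..n. a i) = abar * n" "(\<Sum>i=1..n. c i) = cbar * n"
    using assms(2,8,9) by auto
  note Chernoff = Chernoff_bound_submultiplicative_moments
    [of "{1..n}" X a b c, OF _ _ assms(3-7), simplified sums]
  have "abar * n \<le> cbar * n"
    unfolding sums[symmetric] using Chernoff(2)[of 0] assms(2) by (intro sum_mono) auto
  then have "abar \<le> cbar"
    using assms(2) by simp
  \<comment> \<open>The two ends of the range of \<open>t\<close> give \<open>q \<le> p\<close> and
    \<open>p \<le> 1\<close>.\<close>
  then have q: "0 \<le> q" and qp: "q \<le> p" and p: "p \<le> 1"
    using assms(5,10) by (auto simp: p_def q_def field_simps)
  have "measure M {\<omega> \<in> space M. (\<Sum>i=1..n. X i \<omega>) \<ge> (cbar + t) * real n}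
      \<le> (exp (- u * p) * (1 - q + q * exp u)) ^ n" if "u \<ge> 0" for u
  proof -
    \<comment> \<open>The choice \<open>l = u / b\<close> undoes the scaling by \<open>b\<close>, so
      that only \<open>u\<close>, \<open>p\<close> and \<open>q\<close> remain.\<close>
    have "measure M {\<omega> \<in> space M. (\<Sum>i=1..n. X i \<omega>) \<ge> (cbar + t) * real n}
        \<le> exp (u / b * (abar * n - (cbar + t) * n))
          * (1 + (exp (u / b * b) - 1) / b * ((cbar * n - abar * n) / n)) ^ n"
      using Chernoff(1)[of "u / b" "(cbar + t) * real n"] that assms(2,5) by simp
    also have "u / b * (abar * n - (cbar + t) * n) = - u * p * n"
      using assms(5) by (simp add: p_def field_simps)
    also have "1 + (exp (u / b * b) - 1) / b * ((cbar * n - abar * n) / n) = 1 - q + q * exp u"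
      using assms(2,5) by (simp add: q_def field_simps)
    finally show ?thesis
      by (simp only: exp_of_nat2_mult power_mult_distrib)
  qed
  then show ?thesis
    using le_exp_bin_rel_entropy[OF q qp p assms(2)] by (simp only: p_def q_def)
qed

end
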